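(* Let $\{P_\theta:\theta\in\Theta\}$ be a family of mutually absolutely continuous probability measures (common support) on a measurable space $(S,\mathcal{A})$, and let $g:\Theta\to\mathbb{R}$ be a function that is not constant on $\Theta$. If $R$ is a pointwise assessment criterion for estimating $g$, then no estimate is uniformly $R$-optimal: there is no estimate $t^*$ such that $R_{t^*}(\theta)\le R_t(\theta)$ for every estimate $t$ and every $\theta\in\Theta$.
   Context: An estimate is a measurable function $t:S\to\mathbb{R}$ with $E_\theta(t^2)=\int_S t(s)^2\,dP_\theta(s)<\infty$ for all $\theta\in\Theta$. A pointwise assessment criterion (for the estimand $g$) assigns to each estimate $t$ and each $\theta\in\Theta$ a risk $R_t(\theta)\ge 0$ (possibly $+\infty$) such that: (a) $R_t(\theta)$ is computed from the sampling distribution of $t$ under $P_\theta$ alone, i.e. for each $\theta$, $R_t(\theta)$ depends on $t$ only through the law $P_\theta\circ t^{-1}$; and (b) $R_t(\theta)=0$ if and only if $t=g(\theta)$ $P_\theta$-almost surely. *)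

theory Defs
  imports "HOL-Probability.Probability"
begin

(* The measure M is used only as a carrier of the measurable space (space M, sets M);
   its values as a measure play no role. *)

definition statistical_family ::
  "'s measure \<Rightarrow> 'p set \<Rightarrow> ('p \<Rightarrow> 's measure) \<Rightarrow> bool" where
  "statistical_family M \<Theta> P \<longleftrightarrow> (\<forall>\<theta>\<in>\<Theta>. prob_space (P \<theta>) \<and> sets (P \<theta>) = sets M)"

definition mutually_absolutely_continuous ::
  "'p set \<Rightarrow> ('p \<Rightarrow> 's measure) \<Rightarrow> bool" where
  "mutually_absolutely_continuous \<Theta> P \<longleftrightarrow>
     (\<forall>\<theta>\<in>\<Theta>. \<forall>\<theta>'\<in>\<Theta>. absolutely_continuous (P \<theta>) (P \<theta>'))"

definition estimate ::
  "'s measure \<Rightarrow> 'p set \<Rightarrow> ('p \<Rightarrow> 's measure) \<Rightarrow> ('s \<Rightarrow> real) \<Rightarrow> bool" where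
  "estimate M \<Theta> P t \<longleftrightarrow>
     t \<in> borel_measurable M \<and> (\<forall>\<theta>\<in>\<Theta>. (\<integral>\<^sup>+ s. ennreal ((t s)\<^sup>2) \<partial>P \<theta>) < \<infinity>)"

(* R t \<theta> is the risk of t at \<theta>, and distr (P \<theta>) borel t is the law of t under P \<theta>.
   The values of R at functions that are not estimates, or at parameters outside \<Theta>,
   are irrelevant and left unconstrained. *)

definition pointwise_assessment_criterion ::
  "'s measure \<Rightarrow> 'p set \<Rightarrow> ('p \<Rightarrow> 's measure) \<Rightarrow> ('p \<Rightarrow> real) \<Rightarrow>
   (('s \<Rightarrow> real) \<Rightarrow> 'p \<Rightarrow> ennreal) \<Rightarrow> bool" where
  "pointwise_assessment_criterion M \<Theta> P g R \<longleftrightarrow>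
     (\<forall>\<theta>\<in>\<Theta>. \<forall>t u. estimate M \<Theta> P t \<longrightarrow> estimate M \<Theta> P u \<longrightarrow>
        distr (P \<theta>) borel t = distr (P \<theta>) borel u \<longrightarrow> R t \<theta> = R u \<theta>) \<and>
     (\<forall>\<theta>\<in>\<Theta>. \<forall>t. estimate M \<Theta> P t \<longrightarrow>
        (R t \<theta> = 0 \<longleftrightarrow> (AE s in P \<theta>. t s = g \<theta>)))"

definition uniformly_optimal ::
  "'s measure \<Rightarrow> 'p set \<Rightarrow> ('p \<Rightarrow> 's measure) \<Rightarrow>
   (('s \<Rightarrow> real) \<Rightarrow> 'p \<Rightarrow> ennreal) \<Rightarrow> ('s \<Rightarrow> real) \<Rightarrow> bool" where
  "uniformly_optimal M \<Theta> P R t' \<longleftrightarrow>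
     estimate M \<Theta> P t' \<and>
     (\<forall>t. estimate M \<Theta> P t \<longrightarrow> (\<forall>\<theta>\<in>\<Theta>. R t' \<theta> \<le> R t \<theta>))"

end

(* A uniformly optimal estimate would have risk 0 at every theta, since it competes against the
   constant estimate g theta. It would then equal g theta almost surely for every theta, and
   mutual absolute continuity lets two different values of g be compared under one measure. *)
theory Submission
  imports Defs
begin

text \<open>The second moment is \<open>c\<^sup>2\<close> times the total mass 1, hence finite. This
  admits every constant as a competitor.\<close>

lemma estimate_const:
  assumes "statistical_family M \<Theta> P"
  shows "estimate M \<Theta> P (\<lambda>_. c)"
proof -
  have "(\<integral>\<^sup>+ s. ennreal (c\<^sup>2) \<partial>P \<theta>) < \<infinity>" if "\<theta> \<in> \<Theta>" for \<theta>
  proof -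
    interpret prob_space "P \<theta>"
      using assms that by (simp add: statistical_family_def)
    show ?thesis
      by (simp add: emeasure_space_1)
  qed
  then show ?thesis
    by (simp add: estimate_def)
qed

text \<open>The competitor may change with \<open>\<theta>\<close>, since optimality compares risks
  one parameter at a time; its risk at other parameters does not matter.\<close>

lemma uniformly_optimal_AE_eq:
  assumes "statistical_family M \<Theta> P"
    and "pointwise_assessment_criterion M \<Theta> P g R"
    and "uniformly_optimal M \<Theta> P R t" and "\<theta> \<in> \<Theta>"
  shows "AE s in P \<theta>. t s = g \<theta>"
proof -
  \<comment> \<open>Used in both directions: right to left for the constant competitor, left to
    right for \<open>t\<close>.\<close>
  have zero_iff: "R u \<theta> = 0 \<longleftrightarrow> (AE s in P \<theta>. u s = g \<theta>)"
    if "estimate M \<Theta> P u" for u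
    using assms(2,4) that unfolding pointwise_assessment_criterion_def by blast
  have est: "estimate M \<Theta> P (\<lambda>_. g \<theta>)"
    using assms(1) by (rule estimate_const)
  then have "R (\<lambda>_. g \<theta>) \<theta> = 0"
    by (simp add: zero_iff)
  moreover have "R t \<theta> \<le> R (\<lambda>_. g \<theta>) \<theta>"
    using assms(3,4) est unfolding uniformly_optimal_def by blast
  ultimately have "R t \<theta> = 0"
    by simp
  then show ?thesis
    using assms(3) zero_iff unfolding uniformly_optimal_def by blast
qed

theorem lemma1:
  fixes M :: "'s measure" and \<Theta> :: "'p set" and P :: "'p \<Rightarrow> 's measure"
    and g :: "'p \<Rightarrow> real" and R :: "('s \<Rightarrow> real) \<Rightarrow> 'p \<Rightarrow> ennreal"
  assumes "statistical_family M \<Theta> P"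
    and "mutually_absolutely_continuous \<Theta> P"
    and "\<not> g constant_on \<Theta>"
    and "pointwise_assessment_criterion M \<Theta> P g R"
  shows "\<not> (\<exists>t'. uniformly_optimal M \<Theta> P R t')"
proof
  assume "\<exists>t'. uniformly_optimal M \<Theta> P R t'"
  then obtain t where t: "uniformly_optimal M \<Theta> P R t" ..
  obtain \<theta> \<theta>' where \<theta>: "\<theta> \<in> \<Theta>" "\<theta>' \<in> \<Theta>" "g \<theta> \<noteq> g \<theta>'"
    using assms(3) unfolding constant_on_def by metis
  interpret prob_space "P \<theta>'"
    using assms(1) \<theta> by (simp add: statistical_family_def)
  have eq: "AE s in P \<theta>. t s = g \<theta>" "AE s in P \<theta>'. t s = g \<theta>'"
    using uniformly_optimal_AE_eq[OF assms(1,4) t] \<theta> by auto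
  \<comment> \<open>Direction: null sets of \<open>P \<theta>\<close> are null for
    \<open>P \<theta>'\<close>, so the exceptional set of the first equation in \<open>eq\<close>
    stays negligible under \<open>P \<theta>'\<close>.\<close>
  have "sets (P \<theta>') = sets (P \<theta>)" "absolutely_continuous (P \<theta>) (P \<theta>')"
    using assms(1,2) \<theta>
    by (simp_all add: statistical_family_def mutually_absolutely_continuous_def)
  then have "AE s in P \<theta>'. t s = g \<theta>"
    using eq(1) by (rule absolutely_continuous_AE)
  \<comment> \<open>Where both equations hold, \<open>g \<theta> = g \<theta>'\<close>. So the whole
    space would be null, against total mass 1.\<close>
  with eq(2) have "AE s in P \<theta>'. False"
    by eventually_elim (use \<theta> in simp)
  then show False
    by simp
qed

end
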